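(* The following two statements are equivalent. (a) Every finite bridgeless cubic graph $G$ contains three (not necessarily distinct) perfect matchings $M_1,M_2,M_3$ such that no edge is covered by all of them, i.e. $M_1\cap M_2\cap M_3=\emptyset$. (b) Every infinite bridgeless cubic graph $G$ contains three (not necessarily distinct) perfect matchings $M_1,M_2,M_3$ such that $M_1\cap M_2\cap M_3=\emptyset$.
   Context: Graphs are simple (no loops, no parallel edges), not necessarily connected, and may be infinite. A graph is cubic if every vertex has degree exactly 3, and bridgeless if it has no edge whose deletion increases the number of connected components. A perfect matching of $G$ is a set $M\subseteq E(G)$ such that every vertex of $G$ is incident with exactly one edge of $M$. *)

theory Defs
  imports Main
begin

text \<open>A graph is given by its vertex set and its set of edges, an edge being the set of its two
  ends. Both sets may be infinite.\<close>

definition simple_graph :: "'a set \<Rightarrow> 'a set set \<Rightarrow> bool" where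
  "simple_graph V E \<longleftrightarrow> (\<forall>e\<in>E. e \<subseteq> V \<and> card e = 2)"

definition degree :: "'a set set \<Rightarrow> 'a \<Rightarrow> nat" where
  "degree E v = card {e \<in> E. v \<in> e}"

text \<open>An infinite set has \<open>card\<close> equal to 0, so degree 3 entails that only finitely
  many edges are incident with the vertex.\<close>

definition cubic :: "'a set \<Rightarrow> 'a set set \<Rightarrow> bool" where
  "cubic V E \<longleftrightarrow> (\<forall>v\<in>V. degree E v = 3)"

definition adj :: "'a set set \<Rightarrow> ('a \<times> 'a) set" where
  "adj E = {(u, v). {u, v} \<in> E}"

definition components :: "'a set \<Rightarrow> 'a set set \<Rightarrow> 'a set set" where
  "components V E = V // ((adj E)\<^sup>* \<inter> V \<times> V)"

text \<open>A bridge is an edge whose deletion increases the number of connected components. A graph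
  may have infinitely many components, and then comparing the cardinalities of the two sets of
  components says nothing. The increase is therefore measured by the components that disappear
  and those that arise; there are at most one and two of these, respectively. If there are
  only finitely many components, this is the same as comparing their numbers.\<close>

definition bridge :: "'a set \<Rightarrow> 'a set set \<Rightarrow> 'a set \<Rightarrow> bool" where
  "bridge V E e \<longleftrightarrow> e \<in> E \<and>
     card (components V E - components V (E - {e}))
       < card (components V (E - {e}) - components V E)"

definition bridgeless :: "'a set \<Rightarrow> 'a set set \<Rightarrow> bool" where
  "bridgeless V E \<longleftrightarrow> \<not> (\<exists>e. bridge V E e)"

definition perfect_matching :: "'a set \<Rightarrow> 'a set set \<Rightarrow> 'a set set \<Rightarrow> bool" where
  "perfect_matching V E M \<longleftrightarrow> M \<subseteq> E \<and> (\<forall>v\<in>V. \<exists>!e. e \<in> M \<and> v \<in> e)"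

end

theory Submission
  imports Defs "HOL-Analysis.Function_Topology"
begin

text \<open>An edge is a bridge iff it is the only edge cut by some set of vertices. From (b) to (a), take
  infinitely many disjoint copies of the finite graph. From (a) to (b), compactness leaves only
  finite sets \<open>W\<close> of vertices: matchings have to exist that are perfect at the vertices of \<open>W\<close>.
  Three copies of the subgraph induced by \<open>W\<close>, glued together at new vertices of degree 3, one for
  each edge leaving \<open>W\<close>, form a finite bridgeless cubic graph, and its matchings restrict to the
  edges of one copy.\<close>

text \<open>For an edge with two ends this says that exactly one of them lies in \<open>X\<close>.
  \<open>X\<close> is not confined to the vertex set, so preimages under arbitrary maps can serve as
  cutting sets directly.\<close>

definition edge_cut :: "'a set set \<Rightarrow> 'a set \<Rightarrow> 'a set set" where
  "edge_cut E X = {e \<in> E. e \<inter> X \<noteq> {} \<and> \<not> e \<subseteq> X}"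

definition matching_triple :: "'a set \<Rightarrow> 'a set set \<Rightarrow> bool" where
  "matching_triple V E \<longleftrightarrow> (\<exists>M1 M2 M3. perfect_matching V E M1 \<and> perfect_matching V E M2 \<and>
     perfect_matching V E M3 \<and> M1 \<inter> M2 \<inter> M3 = {})"

subsection \<open>Bridges and cuts\<close>

lemma adj_sym: "(x, y) \<in> adj E \<longleftrightarrow> (y, x) \<in> adj E"
  by (simp add: adj_def insert_commute)

lemma rtrancl_adj_sym: "(x, y) \<in> (adj E)\<^sup>* \<longleftrightarrow> (y, x) \<in> (adj E)\<^sup>*"
  by (metis adj_sym symI sym_rtrancl symD)

lemma simple_edgeE:
  assumes "simple_graph V E" "e \<in> E"
  obtains u v where "e = {u, v}" "u \<noteq> v" "u \<in> V" "v \<in> V"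
  using assms unfolding simple_graph_def by (metis card_2_iff insert_subset)

lemma reach_closed_if_not_cut:
  assumes "edge_cut E X = {}" "(x, y) \<in> (adj E)\<^sup>*" "x \<in> X"
  shows "y \<in> X"
  using assms(2,3)
proof (induction rule: rtrancl_induct)
  case (step y z)
  then have "{y, z} \<in> E" "y \<in> X" by (auto simp: adj_def)
  with assms(1) show ?case unfolding edge_cut_def by blast
qed

text \<open>Take for \<open>X\<close> what remains reachable from one end of \<open>e\<close> once
  \<open>e\<close> is deleted. No other edge leaves \<open>X\<close>, and the second end of
  \<open>e\<close> lies outside, since otherwise no component would change.\<close>

lemma bridge_imp_edge_cut:
  assumes G: "simple_graph V E" and "bridge V E e"
  obtains X where "edge_cut E X = {e}"
proof -
  have e: "e \<in> E" and lt: "card (Defs.components V E - Defs.components V (E - {e}))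
       < card (Defs.components V (E - {e}) - Defs.components V E)"
    using assms(2) by (auto simp: bridge_def)
  obtain u v where uv: "e = {u, v}" "u \<noteq> v" using simple_edgeE[OF G e] by metis
  define X where "X = {x. (u, x) \<in> (adj (E - {e}))\<^sup>*}"
  have "v \<notin> X"
  proof
    assume "v \<in> X"
    then have uv': "(u, v) \<in> (adj (E - {e}))\<^sup>*" by (simp add: X_def)
    then have vu': "(v, u) \<in> (adj (E - {e}))\<^sup>*" by (simp add: rtrancl_adj_sym)
    \<comment> \<open>A path from \<open>u\<close> to \<open>v\<close> avoiding \<open>e\<close> can
      replace every use of \<open>e\<close>, so deleting \<open>e\<close> preserves
      reachability.\<close>
    have "adj E \<subseteq> (adj (E - {e}))\<^sup>*"
    proof clarify
      fix a b assume ab: "(a, b) \<in> adj E"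
      show "(a, b) \<in> (adj (E - {e}))\<^sup>*"
      proof (cases "{a, b} = e")
        case True
        then have "a = u \<and> b = v \<or> a = v \<and> b = u" using uv by (auto simp: doubleton_eq_iff)
        then show ?thesis using uv' vu' by auto
      next
        case False
        with ab show ?thesis by (auto simp: adj_def)
      qed
    qed
    moreover have "adj (E - {e}) \<subseteq> adj E" by (auto simp: adj_def)
    ultimately have "(adj E)\<^sup>* = (adj (E - {e}))\<^sup>*" by (metis rtrancl_subset)
    then have "Defs.components V E = Defs.components V (E - {e})" by (simp add: Defs.components_def)
    with lt show False by simp
  qed
  moreover have "u \<in> X" by (simp add: X_def)
  moreover have "d \<notin> edge_cut E X" if "d \<in> E" "d \<noteq> e" for d
  proof
    assume d: "d \<in> edge_cut E X"
    obtain a b where ab: "d = {a, b}" using simple_edgeE[OF G \<open>d \<in> E\<close>] by metis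
    then have "(a, b) \<in> adj (E - {e})" "(b, a) \<in> adj (E - {e})"
      using \<open>d \<in> E\<close> \<open>d \<noteq> e\<close> by (auto simp: adj_def insert_commute)
    then have "a \<in> X \<longleftrightarrow> b \<in> X" unfolding X_def by (auto intro: rtrancl_into_rtrancl)
    with d ab show False by (auto simp: edge_cut_def)
  qed
  ultimately have "edge_cut E X = {e}" using e uv by (auto simp: edge_cut_def)
  then show thesis by (rule that)
qed

text \<open>Deleting \<open>e\<close> destroys at most one component, the one containing
  \<open>e\<close>, and creates exactly two, those of its ends \<open>u\<close> and
  \<open>v\<close>, which \<open>X\<close> separates.\<close>

lemma edge_cut_imp_bridge:
  assumes G: "simple_graph V E" and cut: "edge_cut E X = {e}"
  shows "bridge V E e"
proof -
  have e: "e \<in> E" using cut by (auto simp: edge_cut_def)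
  obtain u v where uv: "e = {u, v}" "u \<in> V" "v \<in> V" "u \<in> X" "v \<notin> X"
  proof -
    obtain a b where "e = {a, b}" "a \<in> V" "b \<in> V" using simple_edgeE[OF G e] by metis
    moreover have "e \<inter> X \<noteq> {}" "\<not> e \<subseteq> X" using cut by (auto simp: edge_cut_def)
    ultimately show thesis using that[of a b] that[of b a] by (auto simp: insert_commute)
  qed
  define R where "R = (adj E)\<^sup>* \<inter> V \<times> V"
  define R' where "R' = (adj (E - {e}))\<^sup>* \<inter> V \<times> V"
  have R'R: "R' \<subseteq> R" unfolding R_def R'_def
    by (intro Int_mono rtrancl_mono) (auto simp: adj_def)
  have symR: "(x, y) \<in> R \<Longrightarrow> (y, x) \<in> R" and symR': "(x, y) \<in> R' \<Longrightarrow> (y, x) \<in> R'" for x y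
    by (auto simp: R_def R'_def rtrancl_adj_sym)
  have transR: "(x, y) \<in> R \<Longrightarrow> (y, z) \<in> R \<Longrightarrow> (x, z) \<in> R"
    and transR': "(x, y) \<in> R' \<Longrightarrow> (y, z) \<in> R' \<Longrightarrow> (x, z) \<in> R'" for x y z
    by (auto simp: R_def R'_def)
  have reflR: "x \<in> V \<Longrightarrow> (x, x) \<in> R" and reflR': "x \<in> V \<Longrightarrow> (x, x) \<in> R'" for x
    by (auto simp: R_def R'_def)
  have R_uv: "(u, v) \<in> R" using e uv by (auto simp: R_def adj_def)
  have not_uv: "(u, v) \<notin> R'"
  proof
    assume "(u, v) \<in> R'"
    moreover have "edge_cut (E - {e}) X = {}" using cut by (auto simp: edge_cut_def)
    ultimately show False using uv reach_closed_if_not_cut by (metis IntD1 R'_def)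
  qed
  \<comment> \<open>A walk from \<open>x\<close> either avoids \<open>e\<close> or arrives at an end
    of \<open>e\<close> before using it for the first time.\<close>
  have RcasesE: "(x, y) \<in> R' \<or> (x, u) \<in> R' \<or> (x, v) \<in> R'" if "(x, y) \<in> R" for x y
  proof -
    have "x \<in> V" and "(x, y) \<in> (adj E)\<^sup>*" using that by (auto simp: R_def)
    from this(2) show ?thesis
    proof (induction rule: rtrancl_induct)
      case base
      then show ?case using \<open>x \<in> V\<close> reflR' by blast
    next
      case (step y z)
      have yz: "{y, z} \<in> E" using step.hyps(2) by (simp add: adj_def)
      then have V: "y \<in> V" "z \<in> V" using G by (auto simp: simple_graph_def)
      show ?case
      proof (cases "{y, z} = e")
        case True
        then have "y = u \<or> y = v" using uv by (auto simp: doubleton_eq_iff)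
        then show ?thesis using step.IH by auto
      next
        case False
        then have "(y, z) \<in> R'" using yz V by (auto simp: R'_def adj_def)
        then show ?thesis using step.IH transR' by blast
      qed
    qed
  qed
  \<comment> \<open>A component that does not contain \<open>e\<close> survives the
    deletion.\<close>
  have far: "R `` {x} = R' `` {x}" if "x \<in> V" "(x, u) \<notin> R" for x
    using that RcasesE R'R R_uv symR transR by blast
  have same: "R `` {x} = R `` {y}" if "(x, y) \<in> R" for x y
    using that symR transR by blast
  have same': "R' `` {x} = R' `` {y}" if "(x, y) \<in> R'" for x y
    using that symR' transR' by blast
  have old: "Defs.components V E = V // R" and new: "Defs.components V (E - {e}) = V // R'"
    by (simp_all add: Defs.components_def R_def R'_def)
  have "V // R - V // R' \<subseteq> {R `` {u}}"
  proof
    fix C assume "C \<in> V // R - V // R'"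
    then obtain x where "x \<in> V" "C = R `` {x}" "C \<notin> V // R'" by (auto elim: quotientE)
    then show "C \<in> {R `` {u}}" using far same by (metis quotientI singletonI)
  qed
  then have "card (V // R - V // R') \<le> 1"
    using card_mono[of "{R `` {u}}"] by simp
  moreover have "V // R' - V // R = {R' `` {u}, R' `` {v}}"
  proof (intro equalityI subsetI)
    fix C assume "C \<in> V // R' - V // R"
    then obtain x where x: "x \<in> V" "C = R' `` {x}" "C \<notin> V // R" by (auto elim: quotientE)
    then have "(x, u) \<in> R" using far by (metis quotientI)
    then have "(x, u) \<in> R' \<or> (x, v) \<in> R'" using RcasesE by blast
    then show "C \<in> {R' `` {u}, R' `` {v}}" using same' x by blast
  next
    \<comment> \<open>A class of \<open>R'\<close> that misses a vertex \<open>R\<close>-related to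
      \<open>a\<close> is too small to be a class of \<open>R\<close>. Hence the classes of both
      \<open>u\<close> and \<open>v\<close> are new.\<close>
    have no: "R' `` {a} \<notin> V // R" if "a \<in> V" "(a, b) \<in> R" "(a, b) \<notin> R'" for a b
    proof
      assume "R' `` {a} \<in> V // R"
      then obtain x where x: "x \<in> V" "R' `` {a} = R `` {x}" by (auto elim: quotientE)
      then have "(x, a) \<in> R" using reflR' that(1) by blast
      then have "(x, b) \<in> R" using that(2) transR by blast
      with x that(3) show False by blast
    qed
    fix C assume "C \<in> {R' `` {u}, R' `` {v}}"
    then show "C \<in> V // R' - V // R"
      using no[of u v] no[of v u] uv R_uv not_uv symR symR' by (auto intro: quotientI)
  qed
  moreover have "R' `` {u} \<noteq> R' `` {v}" using not_uv reflR' uv(3) by blast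
  ultimately show ?thesis using e by (simp add: bridge_def old new)
qed

lemma bridgeless_iff_edge_cut:
  assumes "simple_graph V E"
  shows "bridgeless V E \<longleftrightarrow> (\<forall>X e. edge_cut E X \<noteq> {e})"
  using assms bridge_imp_edge_cut edge_cut_imp_bridge unfolding bridgeless_def by metis

subsection \<open>Pulling back degrees and perfect matchings\<close>

lemma degree_pullback:
  assumes "{d \<in> E'. p \<in> d} = \<psi> ` {e \<in> E. v \<in> e}" "inj_on \<psi> E"
  shows "degree E' p = degree E v"
  using assms by (simp add: degree_def card_image inj_on_def)

text \<open>\<open>\<psi>\<close> matches the edges at \<open>v\<close> one to one with those at
  \<open>p\<close>, so the unique matching edge at \<open>p\<close> has a unique preimage at
  \<open>v\<close>. The claim concerns a single vertex because one copy in the threefold graph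
  provides this correspondence only at the vertices of \<open>W\<close>.\<close>

lemma perfect_matching_pullback:
  assumes "perfect_matching V' E' M" "p \<in> V'"
    and "{d \<in> E'. p \<in> d} = \<psi> ` {e \<in> E. v \<in> e}" "inj_on \<psi> E"
  shows "\<exists>!e. e \<in> E \<and> \<psi> e \<in> M \<and> v \<in> e"
proof -
  obtain d where d: "d \<in> M" "p \<in> d" and uniq: "\<And>d'. d' \<in> M \<Longrightarrow> p \<in> d' \<Longrightarrow> d' = d"
    and sub: "M \<subseteq> E'"
    using assms(1,2) unfolding perfect_matching_def by metis
  then have "d \<in> {d \<in> E'. p \<in> d}" by blast
  then obtain e where e: "e \<in> E" "v \<in> e" "d = \<psi> e" unfolding assms(3) by blast
  show ?thesis
  proof
    show "e \<in> E \<and> \<psi> e \<in> M \<and> v \<in> e" using e d by simp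
    fix e' assume e': "e' \<in> E \<and> \<psi> e' \<in> M \<and> v \<in> e'"
    then have "\<psi> e' \<in> {d \<in> E'. p \<in> d}" unfolding assms(3) by blast
    then have "p \<in> \<psi> e'" by simp
    then have "\<psi> e' = \<psi> e" using e' uniq e(3) by blast
    then show "e' = e" using assms(4) e e' by (auto dest: inj_onD)
  qed
qed

lemma matching_triple_pullback:
  assumes "matching_triple V' E'"
    and p: "\<And>v. v \<in> V \<Longrightarrow> p v \<in> V'"
    and inc: "\<And>v. v \<in> V \<Longrightarrow> {d \<in> E'. p v \<in> d} = \<psi> ` {e \<in> E. v \<in> e}"
    and inj: "inj_on \<psi> E"
  shows "matching_triple V E"
proof -
  have pm: "perfect_matching V E {e \<in> E. \<psi> e \<in> M}" if "perfect_matching V' E' M" for M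
    using perfect_matching_pullback[OF that p inc inj] by (auto simp: perfect_matching_def conj_assoc)
  obtain M1 M2 M3 where "perfect_matching V' E' M1" "perfect_matching V' E' M2"
    "perfect_matching V' E' M3" "M1 \<inter> M2 \<inter> M3 = {}"
    using assms(1) by (auto simp: matching_triple_def)
  then show ?thesis unfolding matching_triple_def
    by (intro exI[of _ "{e \<in> E. \<psi> e \<in> M1}"] exI[of _ "{e \<in> E. \<psi> e \<in> M2}"]
        exI[of _ "{e \<in> E. \<psi> e \<in> M3}"] conjI pm) auto
qed

subsection \<open>Transport along an injection\<close>

text \<open>Statements (a) and (b) speak of graphs on fixed vertex types. A graph constructed on
  another type has to be moved there, which requires that all notions involved be preserved by maps
  injective on the vertices.\<close>

lemma inj_on_image_edges:
  assumes "simple_graph V E" "inj_on g V"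
  shows "inj_on (image g) E"
  using assms by (auto simp: simple_graph_def intro: inj_on_subset[OF inj_on_image_Pow])

lemma image_incident:
  assumes "simple_graph V E" "inj_on g V" "v \<in> V"
  shows "{d \<in> image g ` E. g v \<in> d} = image g ` {e \<in> E. v \<in> e}"
proof -
  have "g v \<in> g ` e \<longleftrightarrow> v \<in> e" if "e \<in> E" for e
    using assms that by (metis inj_on_image_mem_iff simple_graph_def)
  then show ?thesis by auto
qed

lemma simple_graph_image:
  assumes "simple_graph V E" "inj_on g V"
  shows "simple_graph (g ` V) (image g ` E)"
  using assms inj_on_subset[OF assms(2)] unfolding simple_graph_def
  by (simp add: card_image image_mono)

lemma cubic_image:
  assumes "simple_graph V E" "inj_on g V" "cubic V E"
  shows "cubic (g ` V) (image g ` E)"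
  using degree_pullback[OF image_incident[OF assms(1,2)] inj_on_image_edges[OF assms(1,2)]] assms(3)
  by (simp add: cubic_def)

lemma bridgeless_image:
  assumes "simple_graph V E" "inj_on g V" "bridgeless V E"
  shows "bridgeless (g ` V) (image g ` E)"
proof -
  have "edge_cut (image g ` E) X \<noteq> {d}" for X d
  proof
    assume "edge_cut (image g ` E) X = {d}"
    \<comment> \<open>Meeting \<open>X\<close> and lying in \<open>X\<close> both pass to preimages
      under \<open>g\<close>. Injectivity on edges then keeps the size 1 of the cut.\<close>
    moreover have "edge_cut (image g ` E) X = image g ` edge_cut E (g -` X)"
      by (auto simp: edge_cut_def)
    ultimately have "card (edge_cut E (g -` X)) = 1"
      using inj_on_image_edges[OF assms(1,2)]
      by (metis (no_types, lifting) card_image edge_cut_def inj_on_subset is_singleton_altdef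
          is_singletonI mem_Collect_eq subsetI)
    then show False
      using assms(1,3) by (metis bridgeless_iff_edge_cut card_1_singletonE)
  qed
  then show ?thesis using bridgeless_iff_edge_cut simple_graph_image assms(1,2) by blast
qed

lemma matching_triple_image:
  assumes "simple_graph V E" "inj_on g V" "matching_triple (g ` V) (image g ` E)"
  shows "matching_triple V E"
  using matching_triple_pullback[OF assms(3) _ image_incident[OF assms(1,2)]
      inj_on_image_edges[OF assms(1,2)]] by blast

subsection \<open>Infinitely many copies of a finite graph\<close>

definition copy_edges :: "'a set set \<Rightarrow> ('a \<times> nat) set set" where
  "copy_edges E = {e \<times> {n} | e n. e \<in> E}"

lemma copy_incident: "{d \<in> copy_edges E. (v, n) \<in> d} = (\<lambda>e. e \<times> {n}) ` {e \<in> E. v \<in> e}"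
  by (auto simp: copy_edges_def)

lemma inj_on_copy: "inj_on (\<lambda>e. e \<times> {n}) E"
  by (auto simp: inj_on_def)

lemma simple_graph_copies:
  "simple_graph V E \<Longrightarrow> simple_graph (V \<times> UNIV) (copy_edges E)"
  by (fastforce simp: simple_graph_def copy_edges_def card_cartesian_product)

lemma cubic_copies: "cubic V E \<Longrightarrow> cubic (V \<times> UNIV) (copy_edges E)"
  unfolding cubic_def by (metis degree_pullback[OF copy_incident inj_on_copy] mem_Times_iff prod.collapse)

text \<open>If the only edge cut by \<open>X\<close> lies in copy \<open>n\<close>, the slice of
  \<open>X\<close> at level \<open>n\<close> cuts a single edge of the original graph.\<close>

lemma bridgeless_copies:
  assumes "simple_graph V E" "bridgeless V E"
  shows "bridgeless (V \<times> UNIV) (copy_edges E)"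
proof -
  have "edge_cut (copy_edges E) X \<noteq> {d}" for X d
  proof
    assume cut: "edge_cut (copy_edges E) X = {d}"
    then have "d \<in> edge_cut (copy_edges E) X" by simp
    then obtain e n where d: "d = e \<times> {n}" "e \<in> E" by (auto simp: edge_cut_def copy_edges_def)
    define Y where "Y = {x. (x, n) \<in> X}"
    have iff: "f \<in> edge_cut E Y \<longleftrightarrow> f \<times> {n} \<in> edge_cut (copy_edges E) X" for f
    proof -
      have "f \<times> {n} \<inter> X \<noteq> {} \<longleftrightarrow> f \<inter> Y \<noteq> {}" "f \<times> {n} \<subseteq> X \<longleftrightarrow> f \<subseteq> Y"
        by (auto simp: Y_def)
      moreover have "f \<noteq> {} \<Longrightarrow> f \<times> {n} \<in> copy_edges E \<longleftrightarrow> f \<in> E"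
        by (auto simp: copy_edges_def times_eq_iff)
      ultimately show ?thesis unfolding edge_cut_def by blast
    qed
    have "edge_cut E Y = {e}"
    proof (intro equalityI subsetI)
      fix f assume "f \<in> edge_cut E Y"
      then have "f \<times> {n} = e \<times> {n}" using cut d by (simp add: iff)
      then show "f \<in> {e}" by (auto simp: times_eq_iff)
    next
      fix f assume "f \<in> {e}"
      then show "f \<in> edge_cut E Y" using cut d by (simp add: iff)
    qed
    with assms show False using bridgeless_iff_edge_cut by blast
  qed
  then show ?thesis using bridgeless_iff_edge_cut simple_graph_copies assms(1) by blast
qed

lemma matching_triple_copies:
  assumes "matching_triple (V \<times> UNIV) (copy_edges E)"
  shows "matching_triple V E"
  by (rule matching_triple_pullback[OF assms _ copy_incident inj_on_copy]) auto

subsection \<open>A finite bridgeless cubic graph around a finite vertex set\<close>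

text \<open>The new vertex for an edge \<open>f\<close> leaving \<open>W\<close> is \<open>Inr f\<close>, joined to the three copies of the end
  of \<open>f\<close> in \<open>W\<close>.\<close>

definition lift_edge :: "'a set \<Rightarrow> nat \<Rightarrow> 'a set \<Rightarrow> ('a \<times> nat + 'a set) set" where
  "lift_edge W i e = (\<lambda>w. Inl (w, i)) ` (e \<inter> W) \<union> (if e \<subseteq> W then {} else {Inr e})"

definition triple_vertices :: "'a set set \<Rightarrow> 'a set \<Rightarrow> ('a \<times> nat + 'a set) set" where
  "triple_vertices E W = Inl ` (W \<times> {..<3}) \<union> Inr ` edge_cut E W"

definition triple_edges :: "'a set set \<Rightarrow> 'a set \<Rightarrow> ('a \<times> nat + 'a set) set set" where
  "triple_edges E W = {lift_edge W i e | i e. i < 3 \<and> e \<in> E \<and> e \<inter> W \<noteq> {}}"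

lemma Inl_in_lift_edge [simp]: "Inl (w, k) \<in> lift_edge W i e \<longleftrightarrow> k = i \<and> w \<in> e \<and> w \<in> W"
  by (auto simp: lift_edge_def)

lemma Inr_in_lift_edge [simp]: "Inr d \<in> lift_edge W i e \<longleftrightarrow> d = e \<and> \<not> e \<subseteq> W"
  by (auto simp: lift_edge_def)

text \<open>An edge inside \<open>W\<close> is determined by its trace on \<open>W\<close>. An edge
  leaving \<open>W\<close> is recorded by name in \<open>Inr e\<close>, which keeps apart several
  such edges with the same end in \<open>W\<close>.\<close>

lemma lift_edge_eqD:
  assumes "lift_edge W i e = lift_edge W j d"
  shows "e = d"
proof -
  have "w \<in> e \<inter> W \<Longrightarrow> w \<in> d \<inter> W" "w \<in> d \<inter> W \<Longrightarrow> w \<in> e \<inter> W" for w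
    using assms Inl_in_lift_edge by (metis IntD1 IntD2 IntI)+
  moreover have "\<not> e \<subseteq> W \<Longrightarrow> e = d" "\<not> d \<subseteq> W \<Longrightarrow> e = d"
    using assms Inr_in_lift_edge by metis+
  ultimately show ?thesis by blast
qed

lemma inj_on_lift_edge: "inj_on (lift_edge W i) E"
  by (auto simp: inj_on_def dest: lift_edge_eqD)

text \<open>An end in \<open>W\<close> carries the index of the copy; the lifts of an edge missing
  \<open>W\<close> would all coincide.\<close>

lemma lift_edge_index:
  assumes "lift_edge W i e = lift_edge W j d" "e \<inter> W \<noteq> {}"
  shows "i = j"
proof -
  obtain w where "w \<in> e" "w \<in> W" using assms(2) by blast
  then have "Inl (w, i) \<in> lift_edge W j d" using assms(1) Inl_in_lift_edge by metis
  then show ?thesis by simp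
qed

lemma triple_incident_Inl:
  assumes "w \<in> W" "i < 3"
  shows "{d \<in> triple_edges E W. Inl (w, i) \<in> d} = lift_edge W i ` {e \<in> E. w \<in> e}"
  using assms by (auto simp: triple_edges_def)

lemma triple_incident_Inr:
  assumes "f \<in> edge_cut E W"
  shows "{d \<in> triple_edges E W. Inr f \<in> d} = (\<lambda>i. lift_edge W i f) ` {..<3}"
  using assms by (auto simp: triple_edges_def edge_cut_def)

lemma simple_graph_triple:
  assumes "simple_graph V E"
  shows "simple_graph (triple_vertices E W) (triple_edges E W)"
  unfolding simple_graph_def
proof
  fix p assume "p \<in> triple_edges E W"
  then obtain i e where p: "p = lift_edge W i e" "i < 3" "e \<in> E" "e \<inter> W \<noteq> {}"
    by (auto simp: triple_edges_def)
  obtain a b where ab: "e = {a, b}" "a \<noteq> b" using simple_edgeE[OF assms p(3)] by metis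
  have "p \<subseteq> triple_vertices E W"
    using p by (auto simp: lift_edge_def triple_vertices_def edge_cut_def)
  moreover have "card p = 2"
    using ab p by (cases "a \<in> W"; cases "b \<in> W") (auto simp: lift_edge_def)
  ultimately show "p \<subseteq> triple_vertices E W \<and> card p = 2" ..
qed

lemma finite_triple_vertices:
  assumes "finite W" "W \<subseteq> V" "cubic V E"
  shows "finite (triple_vertices E W)"
proof -
  \<comment> \<open>Degree 3 is a positive \<open>card\<close>, which excludes infinitely many
    incident edges.\<close>
  have "finite {e \<in> E. w \<in> e}" if "w \<in> W" for w
    using that assms by (intro card_ge_0_finite) (auto simp: cubic_def degree_def)
  then have "finite (\<Union>w\<in>W. {e \<in> E. w \<in> e})" using assms(1) by blast
  then have "finite (edge_cut E W)" by (rule rev_finite_subset) (auto simp: edge_cut_def)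
  then show ?thesis using assms(1) by (simp add: triple_vertices_def)
qed

lemma cubic_triple:
  assumes "W \<subseteq> V" "cubic V E"
  shows "cubic (triple_vertices E W) (triple_edges E W)"
  unfolding cubic_def
proof
  fix p assume "p \<in> triple_vertices E W"
  then consider w i where "p = Inl (w, i)" "w \<in> W" "i < 3" | f where "p = Inr f" "f \<in> edge_cut E W"
    by (auto simp: triple_vertices_def)
  then show "degree (triple_edges E W) p = 3"
  proof cases
    case 1
    then have "degree (triple_edges E W) p = degree E w"
      using degree_pullback[OF triple_incident_Inl[OF 1(2,3)] inj_on_lift_edge] by simp
    then show ?thesis using 1 assms by (auto simp: cubic_def)
  next
    case 2
    then have "f \<inter> W \<noteq> {}" by (simp add: edge_cut_def)
    then have "inj_on (\<lambda>i. lift_edge W i f) {..<3}"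
      by (intro inj_onI) (rule lift_edge_index)
    then show ?thesis
      using 2 triple_incident_Inr[OF 2(2)] by (simp add: degree_def card_image)
  qed
qed

text \<open>If \<open>X\<close> cuts a single edge of the threefold graph, say in copy \<open>i\<close>, then it cuts
  no edge in another copy \<open>j\<close>. The vertices on which the copies \<open>i\<close> and \<open>j\<close> of \<open>W\<close> disagree
  about membership in \<open>X\<close> then cut a single edge of the original graph.\<close>

lemma bridgeless_triple:
  assumes G: "simple_graph V E" and br: "bridgeless V E"
  shows "bridgeless (triple_vertices E W) (triple_edges E W)"
proof -
  have "edge_cut (triple_edges E W) X \<noteq> {p}" for X p
  proof
    assume cut: "edge_cut (triple_edges E W) X = {p}"
    then have "p \<in> edge_cut (triple_edges E W) X" by simp
    then obtain i e where p: "p = lift_edge W i e" "i < 3" "e \<in> E" "e \<inter> W \<noteq> {}"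
      by (auto simp: triple_edges_def edge_cut_def)
    obtain j :: nat where j: "j < 3" "j \<noteq> i"
      using that[of 0] that[of 1] by (cases "i = 0") auto
    define Y where "Y = {w \<in> W. (Inl (w, i) \<in> X) \<noteq> (Inl (w, j) \<in> X)}"
    have cut_iff: "lift_edge W k d \<inter> X \<noteq> {} \<and> \<not> lift_edge W k d \<subseteq> X \<longleftrightarrow> k = i \<and> d = e"
      if "k < 3" "d \<in> E" "d \<inter> W \<noteq> {}" for k d
    proof -
      have "lift_edge W k d \<in> triple_edges E W" using that by (auto simp: triple_edges_def)
      then have "lift_edge W k d \<inter> X \<noteq> {} \<and> \<not> lift_edge W k d \<subseteq> X
          \<longleftrightarrow> lift_edge W k d \<in> edge_cut (triple_edges E W) X" by (simp add: edge_cut_def)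
      also have "\<dots> \<longleftrightarrow> lift_edge W k d = lift_edge W i e" using cut p by simp
      also have "\<dots> \<longleftrightarrow> k = i \<and> d = e" using that(3) lift_edge_index lift_edge_eqD by metis
      finally show ?thesis .
    qed
    \<comment> \<open>Modulo 2, \<open>Y\<close> is the sum of the traces of \<open>X\<close> on the
      copies \<open>i\<close> and \<open>j\<close>, so \<open>Y\<close> cuts \<open>d\<close> iff
      \<open>X\<close> cuts exactly one of the two lifts of \<open>d\<close>. For an edge leaving
      \<open>W\<close> the contribution of the shared vertex \<open>Inr d\<close> cancels. By
      \<open>cut_iff\<close> no lift to copy \<open>j\<close> is cut, and only that of
      \<open>e\<close> to copy \<open>i\<close> is.\<close>
    have "d \<in> edge_cut E Y \<longleftrightarrow> d = e" if d: "d \<in> E" for d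
    proof (cases "d \<inter> W = {}")
      case True
      then show ?thesis using p(4) by (auto simp: edge_cut_def Y_def)
    next
      case False
      obtain a b where ab: "d = {a, b}" "a \<in> W"
        using simple_edgeE[OF G d] False by (metis Int_insert_left inf_bot_left insert_commute)
      note i = cut_iff[OF p(2) d False] and j = cut_iff[OF j(1) d False]
      show ?thesis
      proof (cases "b \<in> W")
        case True
        then have "lift_edge W k d = {Inl (a, k), Inl (b, k)}" for k
          using ab by (auto simp: lift_edge_def)
        then show ?thesis using i j \<open>j \<noteq> i\<close> ab True d by (auto simp: edge_cut_def Y_def)
      next
        case False
        then have "lift_edge W k d = {Inl (a, k), Inr d}" for k
          using ab by (auto simp: lift_edge_def)
        then show ?thesis using i j \<open>j \<noteq> i\<close> ab False d by (auto simp: edge_cut_def Y_def)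
      qed
    qed
    then have "edge_cut E Y = {e}" using p(3) by (auto simp: edge_cut_def)
    with G br show False using bridgeless_iff_edge_cut by blast
  qed
  then show ?thesis using bridgeless_iff_edge_cut simple_graph_triple[OF G] by blast
qed

subsection \<open>Compactness\<close>

text \<open>By Tychonoff, the functions into a finite discrete space form a compact product. A
  constraint depending on finitely many coordinates defines a closed set, and the finite
  intersection property gives a common point.\<close>

lemma finite_constraints_compactness:
  fixes S :: "'i \<Rightarrow> 'k set" and P :: "'i \<Rightarrow> ('k \<Rightarrow> 'c::finite) \<Rightarrow> bool"
  assumes fin: "\<And>i. i \<in> I \<Longrightarrow> finite (S i)"
    and loc: "\<And>i f g. i \<in> I \<Longrightarrow> P i f \<Longrightarrow> (\<And>k. k \<in> S i \<Longrightarrow> f k = g k) \<Longrightarrow> P i g"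
    and sat: "\<And>J. finite J \<Longrightarrow> J \<subseteq> I \<Longrightarrow> \<exists>f. \<forall>i\<in>J. P i f"
  shows "\<exists>f. \<forall>i\<in>I. P i f"
proof -
  define T where "T = product_topology (\<lambda>_::'k. discrete_topology (UNIV :: 'c set)) UNIV"
  have top: "topspace T = UNIV" by (simp add: T_def)
  have closed: "closedin T {f. P i f}" if i: "i \<in> I" for i
  proof -
    have "openin T {f. \<not> P i f}"
      unfolding T_def openin_product_topology_alt
    proof
      fix f assume f: "f \<in> {f. \<not> P i f}"
      \<comment> \<open>This basic neighbourhood of \<open>f\<close> freezes the coordinates in
        \<open>S i\<close>, so the constraint fails throughout it.\<close>
      define U where "U k = (if k \<in> S i then {f k} else UNIV)" for k
      have "finite {k. U k \<noteq> UNIV}"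
        by (rule finite_subset[OF _ fin[OF i]]) (auto simp: U_def)
      moreover have "f \<in> Pi\<^sub>E UNIV U" by (auto simp: U_def)
      moreover have "Pi\<^sub>E UNIV U \<subseteq> {f. \<not> P i f}"
      proof clarify
        fix g assume "g \<in> Pi\<^sub>E UNIV U" "P i g"
        have "g k = f k" if "k \<in> S i" for k
          using PiE_mem[OF \<open>g \<in> Pi\<^sub>E UNIV U\<close>, of k] that by (simp add: U_def)
        then show False using f loc[OF i \<open>P i g\<close>] by simp
      qed
      ultimately show "\<exists>U. finite {k \<in> UNIV. U k \<noteq> topspace (discrete_topology UNIV)} \<and>
          (\<forall>k\<in>UNIV. openin (discrete_topology UNIV) (U k)) \<and> f \<in> Pi\<^sub>E UNIV U \<and>
          Pi\<^sub>E UNIV U \<subseteq> {f. \<not> P i f}"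
        by (intro exI[of _ U]) simp
    qed
    moreover have "topspace T - {f. P i f} = {f. \<not> P i f}" using top by auto
    ultimately show ?thesis using top by (simp add: closedin_def)
  qed
  have "compact_space T"
    by (simp add: T_def compact_space_product_topology compact_space_discrete_topology)
  moreover have "\<Inter>\<F> \<noteq> {}" if \<F>: "finite \<F>" "\<F> \<subseteq> (\<lambda>i. {f. P i f}) ` I" for \<F>
  proof -
    obtain J where "J \<subseteq> I" "finite J" "\<F> = (\<lambda>i. {f. P i f}) ` J"
      using finite_subset_image[OF \<F>] by blast
    then show ?thesis using sat[of J] by auto
  qed
  ultimately have "\<Inter>((\<lambda>i. {f. P i f}) ` I) \<noteq> {}"
    using closed unfolding compact_space_fip by (metis (mono_tags, lifting) imageE)
  then show ?thesis by auto
qed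

lemma matching_triple_compactness:
  assumes cub: "cubic V E" and G: "simple_graph V E"
    and local: "\<And>W. finite W \<Longrightarrow> W \<subseteq> V \<Longrightarrow> \<exists>M1 M2 M3.
      (\<forall>M\<in>{M1, M2, M3}. \<forall>v\<in>W. \<exists>!e. e \<in> E \<and> e \<in> M \<and> v \<in> e) \<and> M1 \<inter> M2 \<inter> M3 = {}"
  shows "matching_triple V E"
proof -
  \<comment> \<open>The triple \<open>c e\<close> of truth values records membership of
    \<open>e\<close> in the three matchings. Excluding \<open>(True, True, True)\<close> is imposed
    at each vertex separately, so that \<open>P v\<close> depends only on the three edges at
    \<open>v\<close>; every edge is reached since it has an end in \<open>V\<close>.\<close>
  define P where "P v c \<longleftrightarrow>
      (\<exists>!e. e \<in> {e \<in> E. v \<in> e} \<and> fst (c e)) \<and> (\<exists>!e. e \<in> {e \<in> E. v \<in> e} \<and> fst (snd (c e))) \<and>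
      (\<exists>!e. e \<in> {e \<in> E. v \<in> e} \<and> snd (snd (c e))) \<and> (\<forall>e\<in>{e \<in> E. v \<in> e}. c e \<noteq> (True, True, True))"
    for v and c :: "'a set \<Rightarrow> bool \<times> bool \<times> bool"
  have "\<exists>c. \<forall>v\<in>V. P v c"
  proof (rule finite_constraints_compactness[where S = "\<lambda>v. {e \<in> E. v \<in> e}"])
    fix v assume "v \<in> V"
    then show "finite {e \<in> E. v \<in> e}"
      using cub by (intro card_ge_0_finite) (auto simp: cubic_def degree_def)
  next
    fix v c c' assume P: "P v c" and eq: "\<And>e. e \<in> {e \<in> E. v \<in> e} \<Longrightarrow> c e = c' e"
    have *: "(e \<in> {e \<in> E. v \<in> e} \<and> Q (c e)) = (e \<in> {e \<in> E. v \<in> e} \<and> Q (c' e))" for e Q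
      using eq by metis
    show "P v c'"
      using P eq *[of _ fst] *[of _ "\<lambda>x. fst (snd x)"] *[of _ "\<lambda>x. snd (snd x)"]
      unfolding P_def by simp
  next
    fix W assume "finite W" "W \<subseteq> V"
    from local[OF this] obtain M1 M2 M3 where
      M: "\<forall>M\<in>{M1, M2, M3}. \<forall>v\<in>W. \<exists>!e. e \<in> E \<and> e \<in> M \<and> v \<in> e" "M1 \<inter> M2 \<inter> M3 = {}" by blast
    have "P v (\<lambda>e. (e \<in> M1, e \<in> M2, e \<in> M3))" if "v \<in> W" for v
      using M that unfolding P_def by (auto simp: conj_ac)
    then show "\<exists>c. \<forall>v\<in>W. P v c" by blast
  qed
  then obtain c where c: "\<And>v. v \<in> V \<Longrightarrow> P v c" by blast
  have "{e \<in> E. fst (c e)} \<inter> {e \<in> E. fst (snd (c e))} \<inter> {e \<in> E. snd (snd (c e))} = {}"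
  proof (rule ccontr)
    assume "\<not> ?thesis"
    then obtain e where e: "e \<in> E" "c e = (True, True, True)" by (auto simp: prod_eq_iff)
    moreover obtain v where "v \<in> e" "v \<in> V" using simple_edgeE[OF G e(1)] by (metis insertI1)
    ultimately show False using c[of v] by (auto simp: P_def)
  qed
  moreover have "perfect_matching V E {e \<in> E. fst (c e)}"
    "perfect_matching V E {e \<in> E. fst (snd (c e))}" "perfect_matching V E {e \<in> E. snd (snd (c e))}"
    using c unfolding perfect_matching_def P_def by (auto simp: conj_ac)
  ultimately show ?thesis unfolding matching_triple_def by blast
qed

subsection \<open>The equivalence\<close>

lemma finite_imp_infinite:
  assumes inf: "infinite (UNIV :: 'a set)"
    and fin: "\<And>(V :: 'a set) E. simple_graph V E \<Longrightarrow> finite V \<Longrightarrow> bridgeless V E \<Longrightarrow> cubic V E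
      \<Longrightarrow> matching_triple V E"
    and G: "simple_graph (V :: 'b set) E" "bridgeless V E" "cubic V E"
  shows "matching_triple V E"
proof (rule matching_triple_compactness[OF G(3,1)])
  fix W assume W: "finite W" "W \<subseteq> V"
  define V' where "V' = triple_vertices E W"
  define E' where "E' = triple_edges E W"
  have G': "simple_graph V' E'" "bridgeless V' E'" "cubic V' E'" "finite V'"
    using simple_graph_triple bridgeless_triple cubic_triple finite_triple_vertices G W
    unfolding V'_def E'_def by blast+
  \<comment> \<open>An infinite type contains finite sets of every size, so the finite graph fits
    into it.\<close>
  obtain B :: "'a set" where "finite B" "card B = card V'"
    using infinite_arbitrarily_large[OF inf] by metis
  then obtain g :: "_ \<Rightarrow> 'a" where g: "inj_on g V'"
    using inj_on_iff_card_le[OF G'(4)] by (metis order_refl)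
  have "matching_triple (g ` V') (image g ` E')"
    using G' g by (intro fin simple_graph_image bridgeless_image cubic_image) auto
  then have "matching_triple V' E'" using G'(1) g matching_triple_image by blast
  then obtain M1 M2 M3 where M: "\<forall>M\<in>{M1, M2, M3}. perfect_matching V' E' M" "M1 \<inter> M2 \<inter> M3 = {}"
    by (auto simp: matching_triple_def)
  \<comment> \<open>Copy 0 is an arbitrary choice. An edge common to the three preimages would have
    its lift in all three matchings.\<close>
  have "\<exists>!e. e \<in> E \<and> e \<in> lift_edge W 0 -` M \<and> v \<in> e" if "M \<in> {M1, M2, M3}" "v \<in> W" for M v
  proof -
    have "Inl (v, 0) \<in> V'" using that by (auto simp: V'_def triple_vertices_def)
    moreover have "perfect_matching V' E' M" using M(1) that(1) by blast
    moreover have "{d \<in> E'. Inl (v, 0) \<in> d} = lift_edge W 0 ` {e \<in> E. v \<in> e}"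
      unfolding E'_def by (rule triple_incident_Inl[OF that(2)]) simp
    ultimately show ?thesis
      using perfect_matching_pullback[OF _ _ _ inj_on_lift_edge] by (simp only: vimage_eq)
  qed
  then show "\<exists>M1 M2 M3. (\<forall>M\<in>{M1, M2, M3}. \<forall>v\<in>W. \<exists>!e. e \<in> E \<and> e \<in> M \<and> v \<in> e) \<and>
      M1 \<inter> M2 \<inter> M3 = {}"
    using M(2)
    by (intro exI[of _ "lift_edge W 0 -` M1"] exI[of _ "lift_edge W 0 -` M2"]
        exI[of _ "lift_edge W 0 -` M3"]) auto
qed

lemma infinite_imp_finite:
  assumes inf: "infinite (UNIV :: 'b set)"
    and infin: "\<And>(V :: 'b set) E. simple_graph V E \<Longrightarrow> infinite V \<Longrightarrow> bridgeless V E \<Longrightarrow> cubic V E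
      \<Longrightarrow> matching_triple V E"
    and G: "simple_graph (V :: 'a set) E" "finite V" "bridgeless V E" "cubic V E"
  shows "matching_triple V E"
\<comment> \<open>Copies of the empty graph never become infinite, but there the empty matching
  suffices.\<close>
proof (cases "V = {}")
  case True
  then show ?thesis by (auto simp: matching_triple_def perfect_matching_def)
next
  case False
  obtain h :: "nat \<Rightarrow> 'b" where h: "inj h" using infinite_countable_subset[OF inf] by blast
  define V' where "V' = V \<times> (UNIV :: nat set)"
  \<comment> \<open>As \<open>V\<close> is finite, \<open>V'\<close> is countable, so it embeds into
    the naturals and from there by \<open>h\<close> into the infinite target type.\<close>
  have "countable V'" using G(2) by (simp add: V'_def countable_finite)
  then have g: "inj_on (h \<circ> to_nat_on V') V'"
    using h by (metis comp_inj_on inj_on_subset inj_on_to_nat_on subset_UNIV)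
  have G': "simple_graph V' (copy_edges E)" "bridgeless V' (copy_edges E)" "cubic V' (copy_edges E)"
    using simple_graph_copies bridgeless_copies cubic_copies G unfolding V'_def by blast+
  have "infinite V'" using False by (simp add: V'_def finite_cartesian_product_iff)
  then have "infinite ((h \<circ> to_nat_on V') ` V')" using g finite_imageD by blast
  then have "matching_triple ((h \<circ> to_nat_on V') ` V') (image (h \<circ> to_nat_on V') ` copy_edges E)"
    by (rule infin[OF simple_graph_image[OF G'(1) g] _ bridgeless_image[OF G'(1) g G'(2)]
          cubic_image[OF G'(1) g G'(3)]])
  from matching_triple_image[OF G'(1) g this] show ?thesis
    unfolding V'_def by (rule matching_triple_copies)
qed

theorem theorem3p3:
  assumes "infinite (UNIV :: 'a set)" and "infinite (UNIV :: 'b set)"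
  shows
    "(\<forall>(V :: 'a set) E.
        simple_graph V E \<and> finite V \<and> bridgeless V E \<and> cubic V E \<longrightarrow>
        (\<exists>M1 M2 M3. perfect_matching V E M1 \<and> perfect_matching V E M2 \<and>
           perfect_matching V E M3 \<and> M1 \<inter> M2 \<inter> M3 = {}))
     \<longleftrightarrow>
     (\<forall>(V :: 'b set) E.
        simple_graph V E \<and> infinite V \<and> bridgeless V E \<and> cubic V E \<longrightarrow>
        (\<exists>M1 M2 M3. perfect_matching V E M1 \<and> perfect_matching V E M2 \<and>
           perfect_matching V E M3 \<and> M1 \<inter> M2 \<inter> M3 = {}))"
  unfolding matching_triple_def[symmetric]
proof (intro iffI allI impI; elim conjE)
  fix V :: "'b set" and E
  assume "\<forall>(V :: 'a set) E. simple_graph V E \<and> finite V \<and> bridgeless V E \<and> cubic V E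
      \<longrightarrow> matching_triple V E"
    and "simple_graph V E" "bridgeless V E" "cubic V E"
  then show "matching_triple V E" using finite_imp_infinite[OF assms(1), of V E] by simp
next
  fix V :: "'a set" and E
  assume "\<forall>(V :: 'b set) E. simple_graph V E \<and> infinite V \<and> bridgeless V E \<and> cubic V E
      \<longrightarrow> matching_triple V E"
    and "simple_graph V E" "finite V" "bridgeless V E" "cubic V E"
  then show "matching_triple V E" using infinite_imp_finite[OF assms(2), of V E] by simp
qed

end
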